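(* Let $n\ge1$. For every polynomial $c(x)$ of degree at most $n-1$, putting $d=\tilde U_n^{-1}c$, one has $$\tilde U_n\big(d(-x)\big)=(-1)^{n-1}x^{n-1}c(1/x).$$ In matrix form: $\tilde U_n(1,-x)\tilde U_n^{-1}=(-1)^{n-1}\tilde J_n$, where $(1,-x)$ is $c(x)\mapsto c(-x)$ and $\tilde J_nc(x)=x^{n-1}c(1/x)$.
   Context: Polynomials over $\mathbb{C}$; $(y)_p=y(y-1)\cdots(y-p+1)$, $[y]_k=y(y+1)\cdots(y+k-1)$. $\tilde U_n$ is the linear map on polynomials of degree at most $n-1$ with $\tilde U_nx^p=\frac{(1-x)^{n+1}}{n!}\sum_{m\ge0}(m+1)^{p+1}x^m$ ($0\le p\le n-1$); it is invertible with $\tilde U_n^{-1}x^p=(x-1)_p[x+1]_{n-p-1}$. *)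

theory Defs
  imports Complex_Main
    "HOL-Computational_Algebra.Polynomial_FPS"
    "Jordan_Normal_Form.Matrix"
begin

(* U_monom n p is a polynomial although it is given by a formal power series; fps_of_poly is
   injective, so the description below is unique. *)
definition U_monom :: "nat \<Rightarrow> nat \<Rightarrow> complex poly" where
  "U_monom n p = (THE q. fps_of_poly q =
     fps_const (1 / fact n) * (1 - fps_X) ^ (n + 1) *
     Abs_fps (\<lambda>m. (of_nat m + 1) ^ (p + 1)))"

(* Linear extension from the monomials x^p, p < n; meant for arguments in poly_space n. *)
definition U_tilde :: "nat \<Rightarrow> complex poly \<Rightarrow> complex poly" where
  "U_tilde n c = (\<Sum>p<n. Polynomial.smult (Polynomial.coeff c p) (U_monom n p))"

(* The intended space for n >= 1; natural-number subtraction makes n = 0 coincide with n = 1. *)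
definition poly_space :: "nat \<Rightarrow> complex poly set" where
  "poly_space n = {c. Polynomial.degree c \<le> n - 1}"

definition U_tilde_inv :: "nat \<Rightarrow> complex poly \<Rightarrow> complex poly" where
  "U_tilde_inv n = inv_into (poly_space n) (U_tilde n)"

definition neg_arg :: "complex poly \<Rightarrow> complex poly" where
  "neg_arg c = pcompose c [:0, -1:]"

(* x^(n-1) c(1/x), written out termwise so that it is a polynomial; see poly_J_tilde. *)
definition J_tilde :: "nat \<Rightarrow> complex poly \<Rightarrow> complex poly" where
  "J_tilde n c = (\<Sum>p<n. Polynomial.monom (Polynomial.coeff c p) (n - 1 - p))"

lemma poly_J_tilde:
  assumes "n \<ge> 1" "c \<in> poly_space n" "x \<noteq> 0"
  shows "poly (J_tilde n c) x = x ^ (n - 1) * poly c (1 / x)"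
proof -
  have "poly c (1 / x) = (\<Sum>p\<le>n - 1. Polynomial.coeff c p * (1 / x) ^ p)"
    unfolding poly_altdef using assms(2)
    by (intro sum.mono_neutral_left) (auto simp: poly_space_def Polynomial.coeff_eq_0)
  also have "{..n - 1} = {..<n}"
    using assms(1) by auto
  finally have "x ^ (n - 1) * poly c (1 / x) =
    (\<Sum>p<n. x ^ (n - 1) * (Polynomial.coeff c p * (1 / x) ^ p))"
    by (simp add: sum_distrib_left)
  also have "\<dots> = (\<Sum>p<n. Polynomial.coeff c p * x ^ (n - 1 - p))"
    using assms(3) by (intro sum.cong) (auto simp: power_diff power_divide)
  finally show ?thesis
    by (simp add: J_tilde_def poly_sum poly_monom)
qed

(* Matrix in the basis 1, x, ..., x^(n-1); column j holds the coefficients of the image of x^j. *)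
definition op_mat :: "nat \<Rightarrow> (complex poly \<Rightarrow> complex poly) \<Rightarrow> complex mat" where
  "op_mat n T = mat n n (\<lambda>(i, j). Polynomial.coeff (T (Polynomial.monom 1 j)) i)"

end

theory Submission imports Defs begin

text \<open>
  For a polynomial \<open>d\<close> of degree less than \<open>n\<close>, the image of \<open>d\<close> under \<open>U_tilde n\<close> has generating
  function \<open>(1 - X)\<^sup>n\<^sup>+\<^sup>1 / n! \<Sum>m. (m + 1) d(m + 1) X\<^sup>m\<close>. For
  \<open>d = (x - 1)\<^sub>p [x + 1]\<^bsub>n-p-1\<^esub>\<close> the number \<open>(m + 1) d(m + 1) / n!\<close> is the binomial coefficient
  \<open>m + n - p\<close> over \<open>n\<close>, so the image is \<open>x\<^sup>p\<close>. Replacing \<open>x\<close> by \<open>-x\<close> interchanges, up to the sign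
  \<open>(-1)\<^sup>n\<^sup>-\<^sup>1\<close>, the basis elements with indices \<open>p\<close> and \<open>n - 1 - p\<close>.
\<close>

section \<open>Rising factorials of polynomials and expansion in monomials\<close>

lemma poly_pochhammer:
  fixes q :: "'a::comm_ring_1 poly"
  shows "poly (pochhammer q k) x = pochhammer (poly q x) k"
  by (induction k) (simp_all add: pochhammer_Suc poly_mult poly_add)

lemma pcompose_pochhammer:
  fixes q :: "'a::comm_ring_1 poly"
  shows "pcompose (pochhammer q k) r = pochhammer (pcompose q r) k"
  by (induction k) (simp_all add: pochhammer_Suc pcompose_mult pcompose_add pcompose_1 of_nat_poly
      pcompose_const)

lemma degree_pochhammer_linear:
  fixes a b :: "'a::idom"
  shows "Polynomial.degree (pochhammer [:a, b:] k) \<le> k"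
proof (induction k)
  case (Suc k)
  have "Polynomial.degree ([:a, b:] + of_nat k) \<le> 1"
    by (simp add: of_nat_poly)
  then show ?case
    unfolding pochhammer_Suc
    by (intro order.trans[OF degree_mult_le]) (use Suc in simp)
qed simp

lemma smult_sum_right:
  "Polynomial.smult a (\<Sum>i\<in>A. f i) = (\<Sum>i\<in>A. Polynomial.smult a (f i))"
  by (induction A rule: infinite_finite_induct) (simp_all add: smult_add_right)

lemma poly_space_sum_smult:
  "(\<And>i. i \<in> A \<Longrightarrow> f i \<in> poly_space n) \<Longrightarrow> (\<Sum>i\<in>A. Polynomial.smult (a i) (f i)) \<in> poly_space n"
  unfolding poly_space_def mem_Collect_eq
  by (cases "finite A")
    (auto intro!: degree_sum_le order.trans[OF degree_smult_le])

lemma poly_space_expand: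
  assumes "n \<ge> 1" "c \<in> poly_space n"
  shows "c = (\<Sum>p<n. Polynomial.smult (Polynomial.coeff c p) (Polynomial.monom 1 p))"
proof -
  have "{..n - 1} = {..<n}"
    using assms(1) by auto
  then show ?thesis
    using poly_as_sum_of_monoms'[of c "n - 1"] assms(2)
    by (simp add: poly_space_def smult_monom)
qed

section \<open>Eulerian polynomials and the images of the monomials\<close>

text \<open>
  The recursion for the Eulerian polynomials: differentiate \<open>X \<Sum>m. (m + 1)\<^sup>p\<^sup>+\<^sup>1 X\<^sup>m\<close>.
\<close>

lemma eulerian_poly_exists:
  "\<exists>q :: 'a::field_char_0 poly.
     fps_of_poly q = (1 - fps_X) ^ (p + 2) * Abs_fps (\<lambda>m. (of_nat m + 1) ^ (p + 1))"
proof (induction p)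
  case 0
  have "(1 - fps_X) ^ 2 * Abs_fps (\<lambda>m. of_nat m + 1) = (1 :: 'a fps)"
  proof -
    have "(1 - fps_X) * Abs_fps (\<lambda>m. of_nat m + 1) = Abs_fps (\<lambda>_. 1 :: 'a)"
      by (rule fps_ext) (auto simp: algebra_simps fps_X_mult_nth of_nat_diff)
    moreover have "(1 - fps_X) * Abs_fps (\<lambda>_. 1 :: 'a) = 1"
      by (rule fps_ext) (auto simp: algebra_simps fps_X_mult_nth)
    ultimately show ?thesis
      by (simp add: power2_eq_square mult.assoc)
  qed
  then show ?case
    by (intro exI[of _ 1]) (simp add: power2_eq_square)
next
  case (Suc p)
  then obtain q :: "'a poly" where
    q: "fps_of_poly q = (1 - fps_X) ^ (p + 2) * Abs_fps (\<lambda>m. (of_nat m + 1) ^ (p + 1))"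
    by blast
  define F :: "'a fps" where "F = Abs_fps (\<lambda>m. (of_nat m + 1) ^ (p + 1))"
  \<comment> \<open>From q = (1 - X)^(p+2) F one gets (1 - X) q' = (1 - X)^(p+3) F' - (p + 2) q.
    Hence (1 - X)^(p+3) (F + X F') = (1 - X) q + X ((1 - X) q' + (p + 2) q), which is
    \<open>r\<close>.\<close>
  define r where "r = q + [:0, 1:] * ((1 - [:0, 1:]) * pderiv q - q + Polynomial.smult (of_nat (p + 2)) q)"
  have F_next: "Abs_fps (\<lambda>m. (of_nat m + 1) ^ (p + 2)) = F + fps_X * fps_deriv F"
    by (rule fps_ext) (auto simp: F_def fps_X_mult_nth algebra_simps)
  have dq: "fps_of_poly (pderiv q) =
      (1 - fps_X) ^ (p + 2) * fps_deriv F - of_nat (p + 2) * (1 - fps_X) ^ (p + 1) * F"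
    unfolding fps_of_poly_pderiv q F_def[symmetric] fps_deriv_mult fps_deriv_power'
    by (simp add: mult_ac del: of_nat_add of_nat_Suc power_Suc)
  have "fps_of_poly r = (1 - fps_X) ^ (Suc p + 2) * Abs_fps (\<lambda>m. (of_nat m + 1) ^ (Suc p + 1))"
  proof -
    have "fps_of_poly r = fps_of_poly q + fps_X * ((1 - fps_X) * fps_of_poly (pderiv q)
        - fps_of_poly q + of_nat (p + 2) * fps_of_poly q)"
      by (simp only: r_def fps_of_poly_add fps_of_poly_mult fps_of_poly_diff fps_of_poly_smult
          fps_of_poly_fps_X fps_of_poly_1 fps_of_nat)
    also have "\<dots> = (1 - fps_X) ^ (p + 3) * (F + fps_X * fps_deriv F)"
    proof -
      have "Y * W * F + X * (Y * (Y * W * D - N * W * F) - Y * W * F + N * (Y * W * F))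
          = Y * Y * W * (F + X * D)" if "Y = 1 - X" for X Y W D N :: "'a fps"
        unfolding that by (simp add: algebra_simps)
      from this[OF refl, of fps_X "(1 - fps_X) ^ (p + 1)" "fps_deriv F" "of_nat (p + 2)"]
      show ?thesis
        unfolding dq q F_def[symmetric]
        by (simp add: eval_nat_numeral mult.assoc del: of_nat_add of_nat_Suc)
    qed
    finally show ?thesis
      using F_next by (simp add: eval_nat_numeral)
  qed
  then show ?case by blast
qed

text \<open>Makes the \<open>THE\<close> usable. Since p < n, the exponent n + 1 splits as (n - 1 -
  p) + (p + 2): p + 2 factors 1 - X turn the series into a polynomial, and the others remain as a
  polynomial factor.\<close>

lemma fps_of_poly_U_monom:
  assumes "p < n"
  shows "fps_of_poly (U_monom n p) =
      fps_const (1 / fact n) * (1 - fps_X) ^ (n + 1) * Abs_fps (\<lambda>m. (of_nat m + 1) ^ (p + 1))"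
proof -
  obtain q :: "complex poly" where
    q: "fps_of_poly q = (1 - fps_X) ^ (p + 2) * Abs_fps (\<lambda>m. (of_nat m + 1) ^ (p + 1))"
    using eulerian_poly_exists by blast
  define r where "r = Polynomial.smult (1 / fact n) ([:1, -1:] ^ (n - 1 - p) * q)"
  have X: "fps_of_poly [:1, -1:] = 1 - (fps_X :: complex fps)"
    by (simp add: fps_of_poly_pCons)
  have "n + 1 = (n - 1 - p) + (p + 2)"
    using assms by simp
  then have r: "fps_of_poly r =
      fps_const (1 / fact n) * (1 - fps_X) ^ (n + 1) * Abs_fps (\<lambda>m. (of_nat m + 1) ^ (p + 1))"
    unfolding r_def fps_of_poly_smult fps_of_poly_mult fps_of_poly_power X q
    by (simp only: power_add mult.assoc)
  have "U_monom n p = r"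
    unfolding U_monom_def by (rule the_equality) (use r in \<open>auto simp flip: fps_of_poly_eq_iff\<close>)
  with r show ?thesis by simp
qed

section \<open>\<open>U_tilde\<close> through values at positive integers\<close>

lemma U_tilde_sum_smult:
  "U_tilde n (\<Sum>i\<in>A. Polynomial.smult (a i) (f i)) = (\<Sum>i\<in>A. Polynomial.smult (a i) (U_tilde n (f i)))"
  unfolding U_tilde_def coeff_sum smult_sum smult_sum_right
  by (subst sum.swap) simp

text \<open>The argument enters only through its values at positive integers; injectivity and the
  images of the \<open>U_basis\<close> elements are both read off from this.\<close>

lemma fps_of_poly_U_tilde:
  assumes "n \<ge> 1" "d \<in> poly_space n"
  shows "fps_of_poly (U_tilde n d) = fps_const (1 / fact n) * (1 - fps_X) ^ (n + 1) *
    Abs_fps (\<lambda>m. (of_nat m + 1) * poly d (of_nat m + 1))"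
proof -
  have "fps_of_poly (U_tilde n d) = (\<Sum>p<n. fps_const (Polynomial.coeff d p) *
      (fps_const (1 / fact n) * (1 - fps_X) ^ (n + 1) * Abs_fps (\<lambda>m. (of_nat m + 1) ^ (p + 1))))"
    unfolding U_tilde_def fps_of_poly_sum fps_of_poly_smult
    by (intro sum.cong refl) (simp add: fps_of_poly_U_monom)
  also have "\<dots> = fps_const (1 / fact n) * (1 - fps_X) ^ (n + 1) *
      (\<Sum>p<n. fps_const (Polynomial.coeff d p) * Abs_fps (\<lambda>m. (of_nat m + 1) ^ (p + 1)))"
    by (simp only: sum_distrib_left mult_ac)
  also have "(\<Sum>p<n. fps_const (Polynomial.coeff d p) * Abs_fps (\<lambda>m. (of_nat m + 1) ^ (p + 1))) =
      Abs_fps (\<lambda>m. (of_nat m + 1) * poly d (of_nat m + 1))"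
  proof (rule fps_ext)
    fix m
    have "poly d (of_nat m + 1) = (\<Sum>p<n. Polynomial.coeff d p * (of_nat m + 1) ^ p)"
      by (subst poly_space_expand[OF assms]) (simp add: poly_sum poly_monom)
    then show "fps_nth (\<Sum>p<n. fps_const (Polynomial.coeff d p) * Abs_fps (\<lambda>m. (of_nat m + 1) ^ (p + 1))) m =
        fps_nth (Abs_fps (\<lambda>m. (of_nat m + 1) * poly d (of_nat m + 1))) m"
      by (simp add: fps_sum_nth sum_distrib_left mult_ac)
  qed
  finally show ?thesis .
qed

text \<open>Cancelling the nonzero prefactor leaves equal values at all positive integers, so the
  difference has infinitely many roots.\<close>

lemma inj_on_U_tilde:
  assumes "n \<ge> 1"
  shows "inj_on (U_tilde n) (poly_space n)"
proof (rule inj_onI)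
  fix c d
  assume c: "c \<in> poly_space n" and d: "d \<in> poly_space n" and eq: "U_tilde n c = U_tilde n d"
  define K :: "complex fps" where "K = fps_const (1 / fact n) * (1 - fps_X) ^ (n + 1)"
  have "1 - fps_X \<noteq> (0 :: complex fps)"
    by (metis fps_X_neq_one right_minus_eq)
  then have K: "K \<noteq> 0"
    unfolding K_def by (intro no_zero_divisors power_not_zero) simp_all
  have "K * Abs_fps (\<lambda>m. (of_nat m + 1) * poly c (of_nat m + 1)) =
      K * Abs_fps (\<lambda>m. (of_nat m + 1) * poly d (of_nat m + 1))"
    unfolding K_def fps_of_poly_U_tilde[OF assms c, symmetric] fps_of_poly_U_tilde[OF assms d, symmetric]
    by (simp only: eq)
  with K have F: "Abs_fps (\<lambda>m. (of_nat m + 1) * poly c (of_nat m + 1)) =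
      Abs_fps (\<lambda>m. (of_nat m + 1) * poly d (of_nat m + 1))"
    by (rule mult_left_cancel[THEN iffD1])
  have "poly (c - d) (of_nat m + 1) = 0" for m
  proof -
    have "(of_nat m + 1 :: complex) \<noteq> 0"
      by (metis of_nat_Suc of_nat_eq_0_iff nat.distinct(1) add.commute)
    then show ?thesis using arg_cong[OF F, of "\<lambda>f. fps_nth f m"] by simp
  qed
  then have "range (\<lambda>m. of_nat m + 1) \<subseteq> {x. poly (c - d) x = 0}"
    by auto
  moreover have "infinite (range (\<lambda>m. of_nat m + 1 :: complex))"
    by (intro range_inj_infinite injI) simp
  ultimately have "infinite {x. poly (c - d) x = 0}"
    using finite_subset by blast
  then show "c = d"
    using poly_roots_finite[of "c - d"] by auto
qed

section \<open>The explicit inverse\<close>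

text \<open>
  The polynomial \<open>(x - 1)\<^sub>p [x + 1]\<^bsub>n-p-1\<^esub>\<close>, with the falling factorial written as
  \<open>(-1)\<^sup>p [1 - x]\<^sub>p\<close>.
\<close>

definition U_basis :: "nat \<Rightarrow> nat \<Rightarrow> complex poly" where
  "U_basis n p = Polynomial.smult ((-1) ^ p) (pochhammer [:1, -1:] p * pochhammer [:1, 1:] (n - 1 - p))"

lemma U_basis_in_poly_space:
  assumes "p < n"
  shows "U_basis n p \<in> poly_space n"
proof -
  have "Polynomial.degree (U_basis n p) \<le> p + (n - 1 - p)"
    unfolding U_basis_def
    by (intro order.trans[OF degree_smult_le] order.trans[OF degree_mult_le] add_mono
        degree_pochhammer_linear)
  then show ?thesis using assms by (simp add: poly_space_def)
qed

text \<open>The substitution swaps 1 - x and 1 + x, hence the two rising factorials, whose lengths p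
  and n - 1 - p are exchanged.\<close>

lemma neg_arg_U_basis:
  assumes "p < n"
  shows "neg_arg (U_basis n p) = Polynomial.smult ((-1) ^ (n - 1)) (U_basis n (n - 1 - p))"
proof -
  have [simp]: "n - Suc (n - Suc p) = p"
    using assms by simp
  have "(-1 :: complex) ^ (n - 1) * (-1) ^ (n - 1 - p) = (-1) ^ p"
    using assms by (simp add: minus_one_power_iff flip: power_add)
  then show ?thesis
    by (simp add: neg_arg_def U_basis_def pcompose_smult pcompose_mult pcompose_pochhammer
        pcompose_pCons mult_ac)
qed

lemma poly_U_basis:
  assumes "p < n"
  shows "(of_nat m + 1) * poly (U_basis n p) (of_nat m + 1) =
    (if m < p then 0 else fact n * of_nat (n + (m - p) choose (m - p)))"
proof (cases "m < p")
  case True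
  then show ?thesis
    by (simp add: U_basis_def poly_pochhammer pochhammer_of_nat_eq_0_lemma)
next
  case False
  then obtain k where m: "m = p + k"
    by (metis le_Suc_ex not_less)
  obtain q where n: "n = p + Suc q"
    using assms less_imp_Suc_add by auto
  \<comment> \<open>The factor m + 1 fills the gap between the falling factorial, running down from
    m to k + 1, and the rising one, running from m + 2 to n + k. Together they form (k + 1)...(k +
    n).\<close>
  have "(of_nat m + 1) * poly (U_basis n p) (of_nat m + 1) =
      ((-1) ^ p * pochhammer (- of_nat m) p) *
      ((of_nat m + 1) * pochhammer (of_nat m + 1 + 1 :: complex) q)"
    by (simp add: U_basis_def poly_pochhammer n mult_ac add_ac)
  also have "(-1) ^ p * pochhammer (- of_nat m) p = pochhammer (of_nat k + 1 :: complex) p"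
    using pochhammer_minus'[of "of_nat m :: complex" p] by (simp add: m)
  also have "(of_nat m + 1) * pochhammer (of_nat m + 1 + 1 :: complex) q =
      pochhammer (of_nat k + 1 + of_nat p) (Suc q)"
    unfolding pochhammer_rec by (simp add: m algebra_simps)
  also have "pochhammer (of_nat k + 1 :: complex) p * \<dots> = pochhammer (of_nat k + 1) n"
    unfolding n pochhammer_product' ..
  also have "\<dots> = fact n * of_nat (n + k choose n)"
    by (simp add: binomial_gbinomial gbinomial_pochhammer')
  also have "n + k choose n = n + k choose k"
    using binomial_symmetric[of k "n + k"] by simp
  finally show ?thesis
    by (simp add: m)
qed

text \<open>By the negative binomial series, the values in \<open>poly_U_basis\<close> are the
  coefficients of n! X^p / (1 - X)^(n+1), so the prefactor of \<open>U_tilde\<close> leaves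
  X^p.\<close>

lemma U_tilde_U_basis:
  assumes "p < n"
  shows "U_tilde n (U_basis n p) = Polynomial.monom 1 p"
proof -
  define B where "B = Abs_fps (\<lambda>k. of_nat (n + k choose k) :: complex)"
  have B: "(1 - fps_X) ^ (n + 1) * B = 1"
  proof -
    have "B = inverse ((1 - fps_X) ^ (n + 1))"
      using one_minus_const_fps_X_neg_power'[of "n + 1" "1 :: complex"] by (simp add: B_def)
    then show ?thesis
      by (simp add: inverse_mult_eq_1')
  qed
  have "Abs_fps (\<lambda>m. (of_nat m + 1) * poly (U_basis n p) (of_nat m + 1)) =
      fps_const (fact n) * (fps_X ^ p * B)"
    by (rule fps_ext) (simp add: poly_U_basis[OF assms] B_def fps_X_power_mult_nth)
  then have "fps_of_poly (U_tilde n (U_basis n p)) =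
      (fps_const (1 / fact n) * fps_const (fact n)) * fps_X ^ p * ((1 - fps_X) ^ (n + 1) * B)"
    using assms by (simp add: fps_of_poly_U_tilde U_basis_in_poly_space mult_ac del: fps_const_mult)
  also have "\<dots> = fps_of_poly (Polynomial.monom 1 p)"
    unfolding B by (simp add: fps_of_poly_monom')
  finally show ?thesis
    by (simp add: fps_of_poly_eq_iff)
qed

text \<open>By injectivity, any preimage of \<open>c\<close> inside \<open>poly_space n\<close> is
  the value chosen by \<open>inv_into\<close>.\<close>

lemma U_tilde_inv_eq:
  assumes "n \<ge> 1" "c \<in> poly_space n"
  shows "U_tilde_inv n c = (\<Sum>p<n. Polynomial.smult (Polynomial.coeff c p) (U_basis n p))"
  unfolding U_tilde_inv_def
proof (rule inv_into_f_eq[OF inj_on_U_tilde[OF assms(1)]])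
  show "(\<Sum>p<n. Polynomial.smult (Polynomial.coeff c p) (U_basis n p)) \<in> poly_space n"
    by (intro poly_space_sum_smult U_basis_in_poly_space) simp
  show "U_tilde n (\<Sum>p<n. Polynomial.smult (Polynomial.coeff c p) (U_basis n p)) = c"
    using poly_space_expand[OF assms] by (simp add: U_tilde_sum_smult U_tilde_U_basis)
qed

section \<open>Reversal of coefficients and its matrix form\<close>

lemma neg_arg_sum_smult:
  "neg_arg (\<Sum>i\<in>A. Polynomial.smult (a i) (f i)) = (\<Sum>i\<in>A. Polynomial.smult (a i) (neg_arg (f i)))"
  by (simp add: neg_arg_def pcompose_sum pcompose_smult)

lemma neg_arg_in_poly_space: "c \<in> poly_space n \<Longrightarrow> neg_arg c \<in> poly_space n"
  using degree_pcompose_le[of c "[:0, -1:]"] by (simp add: poly_space_def neg_arg_def)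

lemma U_tilde_neg_arg_U_tilde_inv:
  assumes "n \<ge> 1" "c \<in> poly_space n"
  shows "U_tilde n (neg_arg (U_tilde_inv n c)) = Polynomial.smult ((-1) ^ (n - 1)) (J_tilde n c)"
proof -
  have "U_tilde n (neg_arg (U_tilde_inv n c)) =
      (\<Sum>p<n. Polynomial.smult (Polynomial.coeff c p) (U_tilde n (neg_arg (U_basis n p))))"
    by (simp add: U_tilde_inv_eq[OF assms] neg_arg_sum_smult U_tilde_sum_smult)
  also have "\<dots> = (\<Sum>p<n. Polynomial.smult ((-1) ^ (n - 1))
      (Polynomial.monom (Polynomial.coeff c p) (n - 1 - p)))"
  proof (rule sum.cong[OF refl])
    fix p assume "p \<in> {..<n}"
    then have "p < n" by simp
    have "U_tilde n (Polynomial.smult a (U_basis n (n - 1 - p))) =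
        Polynomial.smult a (Polynomial.monom 1 (n - 1 - p))" for a
      \<comment> \<open>Homogeneity is the linearity rule for a one-term sum.\<close>
      using U_tilde_sum_smult[of n "\<lambda>_. a" "\<lambda>_. U_basis n (n - 1 - p)" "{()}"]
        U_tilde_U_basis[of "n - 1 - p" n] \<open>p < n\<close> by simp
    then show "Polynomial.smult (Polynomial.coeff c p) (U_tilde n (neg_arg (U_basis n p))) =
        Polynomial.smult ((-1) ^ (n - 1)) (Polynomial.monom (Polynomial.coeff c p) (n - 1 - p))"
      using \<open>p < n\<close> by (simp add: neg_arg_U_basis smult_monom mult.commute)
  qed
  finally show ?thesis
    by (simp add: J_tilde_def smult_sum_right)
qed

text \<open>Linearity is asked of the left factor alone. \<open>U_tilde_inv\<close>, whose values
  are controlled only on \<open>poly_space n\<close>, can thus stand on the right.\<close>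

lemma op_mat_mult:
  assumes "n \<ge> 1"
    and S: "\<And>A :: nat set. \<And>a f. S (\<Sum>i\<in>A. Polynomial.smult (a i) (f i)) =
      (\<Sum>i\<in>A. Polynomial.smult (a i) (S (f i)))"
    and T: "\<And>j. j < n \<Longrightarrow> T (Polynomial.monom 1 j) \<in> poly_space n"
  shows "op_mat n S * op_mat n T = op_mat n (\<lambda>c. S (T c))"
proof (rule eq_matI)
  fix i j
  assume "i < dim_row (op_mat n (\<lambda>c. S (T c)))" "j < dim_col (op_mat n (\<lambda>c. S (T c)))"
  then have ij: "i < n" "j < n" by (simp_all add: op_mat_def)
  define c where "c = T (Polynomial.monom 1 j)"
  have "S c = (\<Sum>p<n. Polynomial.smult (Polynomial.coeff c p) (S (Polynomial.monom 1 p)))"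
    using T[OF ij(2)] unfolding c_def[symmetric]
    by (subst poly_space_expand[OF assms(1)]) (simp_all add: S)
  then have "Polynomial.coeff (S c) i =
      (\<Sum>p<n. Polynomial.coeff c p * Polynomial.coeff (S (Polynomial.monom 1 p)) i)"
    by (simp add: coeff_sum)
  then show "(op_mat n S * op_mat n T) $$ (i, j) = op_mat n (\<lambda>c. S (T c)) $$ (i, j)"
    using ij by (simp add: op_mat_def scalar_prod_def c_def atLeast0LessThan mult.commute)
qed (simp_all add: op_mat_def)

theorem theorem8p1:
  fixes n :: nat
  assumes "n \<ge> 1"
  shows "(\<forall>c d :: complex poly. Polynomial.degree c \<le> n - 1 \<and> d = U_tilde_inv n c \<longrightarrow>
            (\<forall>x. x \<noteq> 0 \<longrightarrow>
               poly (U_tilde n (neg_arg d)) x = (-1) ^ (n - 1) * x ^ (n - 1) * poly c (1 / x)))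
       \<and> op_mat n (U_tilde n) * op_mat n neg_arg * op_mat n (U_tilde_inv n)
           = (-1) ^ (n - 1) \<cdot>\<^sub>m op_mat n (J_tilde n)"
proof (intro conjI allI impI)
  fix c d :: "complex poly" and x :: complex
  assume "Polynomial.degree c \<le> n - 1 \<and> d = U_tilde_inv n c" "x \<noteq> 0"
  then show "poly (U_tilde n (neg_arg d)) x = (-1) ^ (n - 1) * x ^ (n - 1) * poly c (1 / x)"
    using assms by (simp add: U_tilde_neg_arg_U_tilde_inv poly_J_tilde poly_space_def)
next
  have monom: "Polynomial.monom 1 j \<in> poly_space n" if "j < n" for j
    using that by (simp add: poly_space_def Polynomial.degree_monom_eq)
  have inv: "U_tilde_inv n (Polynomial.monom 1 j) \<in> poly_space n" if "j < n" for j
    unfolding U_tilde_inv_eq[OF assms monom[OF that]]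
    by (intro poly_space_sum_smult U_basis_in_poly_space) simp
  have "op_mat n (U_tilde n) * op_mat n neg_arg * op_mat n (U_tilde_inv n) =
      op_mat n (\<lambda>c. U_tilde n (neg_arg c)) * op_mat n (U_tilde_inv n)"
    by (simp add: op_mat_mult[OF assms] U_tilde_sum_smult neg_arg_in_poly_space monom)
  also have "\<dots> = op_mat n (\<lambda>c. U_tilde n (neg_arg (U_tilde_inv n c)))"
    by (simp add: op_mat_mult[OF assms] U_tilde_sum_smult neg_arg_sum_smult inv)
  also have "\<dots> = (-1) ^ (n - 1) \<cdot>\<^sub>m op_mat n (J_tilde n)"
    by (rule eq_matI) (simp_all add: op_mat_def U_tilde_neg_arg_U_tilde_inv[OF assms monom])
  finally show "op_mat n (U_tilde n) * op_mat n neg_arg * op_mat n (U_tilde_inv n) =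
      (-1) ^ (n - 1) \<cdot>\<^sub>m op_mat n (J_tilde n)" .
qed

end
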